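(* Let $\mathcal{H}$ be a real Hilbert space, $A_i:\mathcal{H}\rightrightarrows\mathcal{H}$ and $B_i:\mathcal{H}\to\mathcal{H}$ operators for $i=1,\dots,N$, $W$ a mixing matrix, $\gamma_1,\dots,\gamma_N>0$, $\Gamma=\mathrm{diag}(\gamma_1,\dots,\gamma_N)$, $K=((I-W)/2)^{1/2}\succeq 0$, $c>\|\Gamma K^2\Gamma\|$, and $M=(cI-K\Gamma^2K)^{1/2}\succ0$. Define $A(\mathbf{x})=A_1(x_1)\times\dots\times A_N(x_N)$, $B(\mathbf{x})=(B_1(x_1),\dots,B_N(x_N))$ on $\mathcal{H}^N$, and define $\widetilde A,\widetilde C:\mathcal{H}^N\times\mathcal{H}^N\rightrightarrows\mathcal{H}^N\times\mathcal{H}^N$ and $\widetilde B:\mathcal{H}^N\times\mathcal{H}^N\to\mathcal{H}^N\times\mathcal{H}^N$ by $\widetilde A(\mathbf{z},\tilde{\mathbf{z}})=\big(\Gamma A(\Gamma\mathbf{z}),N_{\{0\}}(\tilde{\mathbf{z}})\big)$, $\widetilde B(\mathbf{z},\tilde{\mathbf{z}})=(\Gamma B(\Gamma\mathbf{z}),0)$, $\widetilde C(\mathbf{z},\tilde{\mathbf{z}})=\big(\Gamma K N_{\{0\}}(K\Gamma\mathbf{z}+M\tilde{\mathbf{z}}),\,M N_{\{0\}}(K\Gamma\mathbf{z}+M\tilde{\mathbf{z}})\big)$. Then: (i) $(\mathbf{a},\tilde{\mathbf{a}})\in\mathcal{H}^N\times\mathcal{H}^N$ satisfies $0\in(\widetilde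 A+\widetilde B+\widetilde C)(\mathbf{a},\tilde{\mathbf{a}})$ if and only if $\mathbf{a}=\Gamma^{-1}(z,\dots,z)$ for some $z\in\mathcal{H}$ with $0\in\sum_{i=1}^N(A_i+B_i)(z)$; (ii) if $A_1,\dots,A_N$ are maximally monotone and each $B_i$ is monotone and $L_i$-Lipschitz continuous, then $\widetilde A$ and $\widetilde C$ are maximally monotone and $\widetilde B$ is monotone and $L$-Lipschitz continuous with $L=\max_i\{\gamma_i^2L_i\}$.
   Context: Real $N\times N$ matrices act on $\mathcal{H}^N$ via Kronecker product with the identity of $\mathcal{H}$; square roots and definiteness refer to these (symmetric positive semidefinite) matrices. A mixing matrix for a connected graph $(\{1,\dots,N\},\mathcal{E})$ is $W=(w_{ij})\in\mathbb{R}^{N\times N}$ with $w_{ij}=0$ if $i\ne j$ and $(i,j)\notin\mathcal{E}$, $W=W^\top$, $\ker(I-W)=\mathbb{R}\mathbf{1}$, and $-I\prec W\preceq I$. $N_{\{0\}}$ denotes the normal cone of $\{0\}\subset\mathcal{H}^N$: $N_{\{0\}}(0)=\mathcal{H}^N$, $N_{\{0\}}(\mathbf{w})=\varnothing$ for $\mathbf{w}\ne0$. *)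

theory Defs
  imports "HOL-Analysis.Analysis"
begin

text \<open>A real N x N matrix acting on H^N via the Kronecker product with the identity of H.\<close>
definition kron_act :: "real^'n^'n \<Rightarrow> 'a::real_vector^'n \<Rightarrow> 'a^'n" where
  "kron_act P x = (\<chi> i. \<Sum>j\<in>UNIV. (P$i$j) *\<^sub>R (x$j))"

definition diag_mat :: "('n::finite \<Rightarrow> real) \<Rightarrow> real^'n^'n" where
  "diag_mat g = (\<chi> i j. if i = j then g i else 0)"

definition sym_mat :: "real^'n^'n \<Rightarrow> bool" where
  "sym_mat P \<longleftrightarrow> transpose P = P"

text \<open>Positive semidefinite / positive definite (for symmetric matrices).\<close>
definition psd_mat :: "real^'n^'n \<Rightarrow> bool" where
  "psd_mat P \<longleftrightarrow> sym_mat P \<and> (\<forall>x. 0 \<le> x \<bullet> (P *v x))"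

definition pd_mat :: "real^'n^'n \<Rightarrow> bool" where
  "pd_mat P \<longleftrightarrow> sym_mat P \<and> (\<forall>x. x \<noteq> 0 \<longrightarrow> 0 < x \<bullet> (P *v x))"

text \<open>Connected undirected graph on the finite vertex type 'n.\<close>
definition connected_graph :: "('n \<times> 'n) set \<Rightarrow> bool" where
  "connected_graph E \<longleftrightarrow> (\<forall>i j. (i, j) \<in> (E \<union> E\<inverse>)\<^sup>*)"

definition mixing_matrix :: "('n::finite \<times> 'n) set \<Rightarrow> real^'n^'n \<Rightarrow> bool" where
  "mixing_matrix E W \<longleftrightarrow>
     (\<forall>i j. i \<noteq> j \<and> (i, j) \<notin> E \<longrightarrow> W$i$j = 0) \<and>
     sym_mat W \<and>
     {x. (mat 1 - W) *v x = 0} = {x. \<exists>t::real. x = t *\<^sub>R vec 1} \<and>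
     pd_mat (W + mat 1) \<and> psd_mat (mat 1 - W)"

text \<open>Normal cone of {0}.\<close>
definition normal_cone_zero :: "'b::zero \<Rightarrow> 'b set" where
  "normal_cone_zero w = (if w = 0 then UNIV else {})"

text \<open>Monotone / maximally monotone set-valued operators, monotone single-valued operators.\<close>
definition monotone_op :: "('b::real_inner \<Rightarrow> 'b set) \<Rightarrow> bool" where
  "monotone_op T \<longleftrightarrow> (\<forall>x y u v. u \<in> T x \<longrightarrow> v \<in> T y \<longrightarrow> 0 \<le> (x - y) \<bullet> (u - v))"

definition max_monotone_op :: "('b::real_inner \<Rightarrow> 'b set) \<Rightarrow> bool" where
  "max_monotone_op T \<longleftrightarrow> monotone_op T \<and>
     (\<forall>x u. (\<forall>y v. v \<in> T y \<longrightarrow> 0 \<le> (x - y) \<bullet> (u - v)) \<longrightarrow> u \<in> T x)"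

definition monotone_fun :: "('b::real_inner \<Rightarrow> 'b) \<Rightarrow> bool" where
  "monotone_fun F \<longleftrightarrow> (\<forall>x y. 0 \<le> (x - y) \<bullet> (F x - F y))"

text \<open>Product operators A and B on H^N.\<close>
definition prod_op :: "('n::finite \<Rightarrow> 'a \<Rightarrow> 'a set) \<Rightarrow> 'a^'n \<Rightarrow> ('a^'n) set" where
  "prod_op A x = {y. \<forall>i. y$i \<in> A i (x$i)}"

definition prod_fun :: "('n::finite \<Rightarrow> 'a \<Rightarrow> 'a) \<Rightarrow> 'a^'n \<Rightarrow> 'a^'n" where
  "prod_fun B x = (\<chi> i. B i (x$i))"

text \<open>The operators tilde A, tilde B, tilde C on H^N x H^N.\<close>
definition tA :: "('n::finite \<Rightarrow> 'a::real_vector \<Rightarrow> 'a set) \<Rightarrow> real^'n^'n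
                   \<Rightarrow> ('a^'n) \<times> ('a^'n) \<Rightarrow> (('a^'n) \<times> ('a^'n)) set" where
  "tA A G p = (kron_act G ` prod_op A (kron_act G (fst p))) \<times> normal_cone_zero (snd p)"

definition tB :: "('n::finite \<Rightarrow> 'a::real_vector \<Rightarrow> 'a) \<Rightarrow> real^'n^'n
                   \<Rightarrow> ('a^'n) \<times> ('a^'n) \<Rightarrow> ('a^'n) \<times> ('a^'n)" where
  "tB B G p = (kron_act G (prod_fun B (kron_act G (fst p))), 0)"

definition tC :: "real^'n^'n \<Rightarrow> real^'n^'n \<Rightarrow> real^'n^'n
                   \<Rightarrow> ('a::real_vector^'n::finite) \<times> ('a^'n) \<Rightarrow> (('a^'n) \<times> ('a^'n)) set" where
  "tC G K M p = (\<lambda>v. (kron_act (G ** K) v, kron_act M v)) `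
       normal_cone_zero (kron_act (K ** G) (fst p) + kron_act M (snd p))"

text \<open>Sum of two set-valued operators and a single-valued one.\<close>
definition sum_op3 :: "('b \<Rightarrow> 'b set) \<Rightarrow> ('b \<Rightarrow> 'b) \<Rightarrow> ('b \<Rightarrow> 'b set) \<Rightarrow> 'b \<Rightarrow> ('b::plus) set" where
  "sum_op3 T F S x = {u + F x + w | u w. u \<in> T x \<and> w \<in> S x}"

end

theory Submission
  imports Defs
begin

text \<open>
  (i) The first block of \<open>0 \<in> (tA + tB + tC)(a, a2)\<close> reads \<open>\<Gamma>(q + B(\<Gamma>a) + K v) = 0\<close> with
  \<open>q \<in> A(\<Gamma>a)\<close>; the normal cones of \<open>{0}\<close> force \<open>a2 = 0\<close> and \<open>K\<Gamma>a = 0\<close> and absorb the second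
  block. As \<open>K\<close> is symmetric with \<open>ker K = ker (I - W) = \<real>1\<close>, on \<open>H\<^sup>N\<close> its kernel consists of
  the consensus vectors \<open>(z, \<dots>, z)\<close> and its range of the vectors with zero sum, which turns the
  inclusion into \<open>0 \<in> \<Sum>\<^sub>i (A\<^sub>i + B\<^sub>i)(z)\<close> with \<open>\<Gamma>a = (z, \<dots>, z)\<close>. Facts about \<open>H\<^sup>N\<close> reduce to
  facts about \<open>\<real>\<^sup>N\<close> by pairing every coordinate with a fixed \<open>h \<in> H\<close>.

  (ii) \<open>tA\<close> is the product of the rescaled operators \<open>\<gamma>\<^sub>i A\<^sub>i(\<gamma>\<^sub>i \<cdot>)\<close> with the normal cone of \<open>{0}\<close>;
  maximal monotonicity passes to products because the pairing splits over the factors and every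
  maximally monotone graph comes arbitrarily close, in the pairing, to any given point.
  \<open>tC = L\<^sup>T N L\<close> for the surjective map \<open>L(z, z2) = K\<Gamma>z + M z2\<close> and the normal cone \<open>N\<close> of \<open>{0}\<close>,
  i.e. \<open>tC\<close> is the normal cone of the subspace \<open>ker L\<close>. \<open>tB\<close> is the product of the monotone maps
  \<open>\<gamma>\<^sub>i B\<^sub>i(\<gamma>\<^sub>i \<cdot>)\<close>, which are \<open>\<gamma>\<^sub>i\<^sup>2 L\<^sub>i\<close>-Lipschitz.
\<close>

section \<open>Monotone and maximally monotone operators\<close>

lemma max_monotone_opE:
  assumes "max_monotone_op T" "u \<notin> T x"
  obtains z w where "w \<in> T z" "(x - z) \<bullet> (u - w) < 0"
  using assms unfolding max_monotone_op_def by (meson not_le)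

lemma max_monotone_op_gapE:
  assumes "max_monotone_op T" "0 < e"
  obtains z w where "w \<in> T z" "(x - z) \<bullet> (u - w) < e"
proof (cases "u \<in> T x")
  case True
  moreover have "(x - x) \<bullet> (u - u) < e" using assms(2) by simp
  ultimately show ?thesis by (rule that)
next
  case False
  then obtain z w where "w \<in> T z" "(x - z) \<bullet> (u - w) < 0"
    by (rule max_monotone_opE[OF assms(1)])
  with assms(2) show ?thesis
    by (intro that[of w z]) simp_all
qed

lemma eq_0_if_multiples_bounded:
  fixes a c :: real
  assumes "\<And>s. s * a \<le> c"
  shows "a = 0"
proof (rule ccontr)
  assume "a \<noteq> 0"
  then have "((\<bar>c\<bar> + 1) / a) * a = \<bar>c\<bar> + 1" by simp
  then show False using assms[of "(\<bar>c\<bar> + 1) / a"] by linarith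
qed

lemma max_monotone_op_scaled:
  fixes T :: "'a::real_inner \<Rightarrow> 'a set"
  assumes "c \<noteq> 0" and T: "max_monotone_op T"
  shows "max_monotone_op (\<lambda>x. (*\<^sub>R) c ` T (c *\<^sub>R x))"
proof -
  have scale: "(x - y) \<bullet> (c *\<^sub>R u - c *\<^sub>R v) = (c *\<^sub>R x - c *\<^sub>R y) \<bullet> (u - v)" for x y u v :: 'a
    by (simp add: scaleR_diff_right[symmetric])
  have T_mono: "monotone_op T" and T_max: "\<And>x u. \<forall>y v. v \<in> T y \<longrightarrow> 0 \<le> (x - y) \<bullet> (u - v) \<Longrightarrow> u \<in> T x"
    using T unfolding max_monotone_op_def by blast+
  show ?thesis
    unfolding max_monotone_op_def monotone_op_def
  proof (intro conjI allI impI)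
    fix x y u v
    assume "u \<in> (*\<^sub>R) c ` T (c *\<^sub>R x)" "v \<in> (*\<^sub>R) c ` T (c *\<^sub>R y)"
    then obtain u' v' where "u' \<in> T (c *\<^sub>R x)" "v' \<in> T (c *\<^sub>R y)" "u = c *\<^sub>R u'" "v = c *\<^sub>R v'"
      by blast
    then show "0 \<le> (x - y) \<bullet> (u - v)"
      using T_mono unfolding monotone_op_def by (simp add: scale)
  next
    fix x u
    assume mono: "\<forall>y v. v \<in> (*\<^sub>R) c ` T (c *\<^sub>R y) \<longrightarrow> 0 \<le> (x - y) \<bullet> (u - v)"
    have "0 \<le> (c *\<^sub>R x - z) \<bullet> (u /\<^sub>R c - w)" if "w \<in> T z" for z w
    proof -
      have "0 \<le> (x - z /\<^sub>R c) \<bullet> (u - c *\<^sub>R w)"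
        using mono \<open>c \<noteq> 0\<close> that by auto
      then show ?thesis
        using scale[of x "z /\<^sub>R c" "u /\<^sub>R c" w] \<open>c \<noteq> 0\<close> by simp
    qed
    then have "u /\<^sub>R c \<in> T (c *\<^sub>R x)"
      using T_max by blast
    then show "u \<in> (*\<^sub>R) c ` T (c *\<^sub>R x)"
      using \<open>c \<noteq> 0\<close> by (intro image_eqI[of _ _ "u /\<^sub>R c"]) simp_all
  qed
qed

lemma max_monotone_prod_op_gapE:
  fixes A :: "'n::finite \<Rightarrow> 'a::real_inner \<Rightarrow> 'a set"
  assumes A: "\<And>i. max_monotone_op (A i)" and "0 < e"
  obtains y v where "v \<in> prod_op A y" "\<And>j. (x $ j - y $ j) \<bullet> (u $ j - v $ j) < e"
proof -
  have "\<exists>zw. snd zw \<in> A j (fst zw) \<and> (x $ j - fst zw) \<bullet> (u $ j - snd zw) < e" for j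
  proof -
    obtain z w where "w \<in> A j z" "(x $ j - z) \<bullet> (u $ j - w) < e"
      using max_monotone_op_gapE[OF A \<open>0 < e\<close>] .
    then show ?thesis by (intro exI[of _ "(z, w)"]) simp
  qed
  then obtain f where f: "\<And>j. snd (f j) \<in> A j (fst (f j))"
    "\<And>j. (x $ j - fst (f j)) \<bullet> (u $ j - snd (f j)) < e"
    using choice[of "\<lambda>j zw. snd zw \<in> A j (fst zw) \<and> (x $ j - fst zw) \<bullet> (u $ j - snd zw) < e"]
    by blast
  show ?thesis
    by (rule that[of "\<chi> j. snd (f j)" "\<chi> j. fst (f j)"]) (simp_all add: prod_op_def f)
qed

lemma max_monotone_prod_op:
  fixes A :: "'n::finite \<Rightarrow> 'a::real_inner \<Rightarrow> 'a set"
  assumes A: "\<And>i. max_monotone_op (A i)"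
  shows "max_monotone_op (prod_op A)"
  unfolding max_monotone_op_def
proof (intro conjI allI impI)
  have "monotone_op (A i)" for i
    using A unfolding max_monotone_op_def by blast
  then show "monotone_op (prod_op A)"
    unfolding monotone_op_def prod_op_def inner_vec_def by (auto intro!: sum_nonneg) blast
next
  fix x u :: "'a^'n"
  assume mono: "\<forall>y v. v \<in> prod_op A y \<longrightarrow> 0 \<le> (x - y) \<bullet> (u - v)"
  have "u $ i \<in> A i (x $ i)" for i
  proof (rule ccontr)
    assume "u $ i \<notin> A i (x $ i)"
    then obtain zi wi where zwi: "wi \<in> A i zi" and neg: "(x $ i - zi) \<bullet> (u $ i - wi) < 0"
      using max_monotone_opE[OF A] by blast
    define d where "d = - ((x $ i - zi) \<bullet> (u $ i - wi))"
    define N where "N = real CARD('n)"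
    have "d > 0" "N \<ge> 1" using neg by (simp_all add: d_def N_def)
    then have "d / N > 0" by simp
    obtain y' v' where yv': "v' \<in> prod_op A y'"
      "\<And>j. (x $ j - y' $ j) \<bullet> (u $ j - v' $ j) < d / N"
      by (rule max_monotone_prod_op_gapE[of A "d / N" x u, OF A \<open>d / N > 0\<close>]) blast
    \<comment> \<open>Put the violating pair into coordinate i: the other N - 1 coordinates add less than d.\<close>
    define y :: "'a^'n" where "y = (\<chi> j. if j = i then zi else y' $ j)"
    define v :: "'a^'n" where "v = (\<chi> j. if j = i then wi else v' $ j)"
    let ?g = "\<lambda>j. (x $ j - y $ j) \<bullet> (u $ j - v $ j)"
    have "v \<in> prod_op A y"
      using zwi yv'(1) by (simp add: prod_op_def y_def v_def)
    then have "0 \<le> (\<Sum>j\<in>UNIV. ?g j)"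
      using mono by (simp add: inner_vec_def)
    also have "\<dots> = - d + (\<Sum>j\<in>UNIV - {i}. ?g j)"
      by (simp add: sum.remove[of UNIV i] y_def v_def d_def)
    also have "(\<Sum>j\<in>UNIV - {i}. ?g j) \<le> (\<Sum>j\<in>UNIV - {i}. d / N)"
      using yv'(2) by (intro sum_mono less_imp_le) (simp add: y_def v_def)
    also have "\<dots> = (N - 1) * (d / N)"
      by (simp add: N_def card_Diff_singleton of_nat_diff)
    finally have "d \<le> (N - 1) * (d / N)" by simp
    moreover have "(N - 1) * (d / N) < d"
      using \<open>d > 0\<close> \<open>N \<ge> 1\<close> by (simp add: field_simps)
    ultimately show False by simp
  qed
  then show "u \<in> prod_op A x" by (simp add: prod_op_def)
qed

lemma max_monotone_op_Times:
  fixes S :: "'a::real_inner \<Rightarrow> 'a set" and T :: "'b::real_inner \<Rightarrow> 'b set"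
  assumes S: "max_monotone_op S" and T: "max_monotone_op T"
  shows "max_monotone_op (\<lambda>p. S (fst p) \<times> T (snd p))"
  unfolding max_monotone_op_def
proof (intro conjI allI impI)
  have "monotone_op S" "monotone_op T"
    using S T unfolding max_monotone_op_def by blast+
  then show "monotone_op (\<lambda>p. S (fst p) \<times> T (snd p))"
    unfolding monotone_op_def
  proof (intro allI impI)
    fix p q U V :: "'a \<times> 'b"
    assume "U \<in> S (fst p) \<times> T (snd p)" "V \<in> S (fst q) \<times> T (snd q)"
    then have "0 \<le> (fst p - fst q) \<bullet> (fst U - fst V)" "0 \<le> (snd p - snd q) \<bullet> (snd U - snd V)"
      using \<open>monotone_op S\<close> \<open>monotone_op T\<close> unfolding monotone_op_def mem_Times_iff by blast+
    then show "0 \<le> (p - q) \<bullet> (U - V)" by (simp add: inner_prod_def)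
  qed
next
  fix p U :: "'a \<times> 'b"
  assume mono: "\<forall>q V. V \<in> S (fst q) \<times> T (snd q) \<longrightarrow> 0 \<le> (p - q) \<bullet> (U - V)"
  have "fst U \<in> S (fst p)"
  proof (rule ccontr)
    assume "fst U \<notin> S (fst p)"
    then obtain z w where "w \<in> S z" and neg: "0 < - ((fst p - z) \<bullet> (fst U - w))"
      using max_monotone_opE[OF S] by (metis neg_0_less_iff_less)
    moreover obtain z' w' where "w' \<in> T z'" "(snd p - z') \<bullet> (snd U - w') < - ((fst p - z) \<bullet> (fst U - w))"
      using max_monotone_op_gapE[OF T neg] .
    ultimately show False
      using mono[rule_format, of "(w, w')" "(z, z')"] by (simp add: inner_prod_def)
  qed
  moreover have "snd U \<in> T (snd p)"
  proof (rule ccontr)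
    assume "snd U \<notin> T (snd p)"
    then obtain z' w' where "w' \<in> T z'" and neg: "0 < - ((snd p - z') \<bullet> (snd U - w'))"
      using max_monotone_opE[OF T] by (metis neg_0_less_iff_less)
    moreover obtain z w where "w \<in> S z" "(fst p - z) \<bullet> (fst U - w) < - ((snd p - z') \<bullet> (snd U - w'))"
      using max_monotone_op_gapE[OF S neg] .
    ultimately show False
      using mono[rule_format, of "(w, w')" "(z, z')"] by (simp add: inner_prod_def)
  qed
  ultimately show "U \<in> S (fst p) \<times> T (snd p)" by (simp add: mem_Times_iff)
qed

lemma max_monotone_op_normal_cone_ker:
  fixes L :: "'b::real_inner \<Rightarrow> 'c::real_inner"
  assumes L: "linear L" and L_adj: "\<And>x v. L x \<bullet> v = x \<bullet> L' v"
    and right_inv: "\<And>v. L (R v) = v" and R_adj: "\<And>v x. R v \<bullet> x = v \<bullet> R' x"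
  shows "max_monotone_op (\<lambda>p. L' ` normal_cone_zero (L p))"
  unfolding max_monotone_op_def monotone_op_def
proof (intro conjI allI impI)
  fix p q U V
  assume "U \<in> L' ` normal_cone_zero (L p)" "V \<in> L' ` normal_cone_zero (L q)"
  then show "0 \<le> (p - q) \<bullet> (U - V)"
    by (auto simp: normal_cone_zero_def inner_diff_left inner_diff_right L_adj[symmetric] split: if_splits)
next
  fix p u
  assume mono: "\<forall>q V. V \<in> L' ` normal_cone_zero (L q) \<longrightarrow> 0 \<le> (p - q) \<bullet> (u - V)"
  then have mono': "0 \<le> (p - q) \<bullet> (u - L' v)" if "L q = 0" for q v
    using that by (simp add: normal_cone_zero_def)
  have "s * (L p \<bullet> L p) \<le> p \<bullet> u" for s
    using mono'[of 0 "s *\<^sub>R L p"] by (simp add: linear_0[OF L] inner_diff_right L_adj[symmetric])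
  then have Lp: "L p = 0"
    using eq_0_if_multiples_bounded by fastforce
  have L'_0: "L' 0 = 0"
    using L_adj[of "L' 0" 0] by simp
  \<comment> \<open>\<open>y - R (L y)\<close> sweeps out \<open>ker L\<close>, so \<open>u \<perp> ker L\<close>; the right inverse turns this into \<open>u \<in> range L'\<close>.\<close>
  have orth: "(y - R (L y)) \<bullet> u = 0" for y
  proof -
    have "L (p + s *\<^sub>R (y - R (L y))) = 0" for s
      by (simp add: Lp right_inv linear_add[OF L] linear_diff[OF L] linear_scale[OF L])
    then have "s * ((y - R (L y)) \<bullet> u) \<le> 0" for s
      using mono'[of "p + s *\<^sub>R (y - R (L y))" 0] by (simp add: L'_0)
    then show ?thesis
      using eq_0_if_multiples_bounded by blast
  qed
  have "u \<bullet> y = L' (R' u) \<bullet> y" for y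
  proof -
    have "u \<bullet> y = R (L y) \<bullet> u"
      using orth[of y] by (simp add: inner_diff_left inner_commute[of u])
    also have "\<dots> = y \<bullet> L' (R' u)"
      by (simp add: R_adj L_adj)
    finally show ?thesis by (simp add: inner_commute)
  qed
  then have "u = L' (R' u)"
    by (metis inner_diff_left inner_eq_zero_iff right_minus_eq)
  then show "u \<in> L' ` normal_cone_zero (L p)"
    by (simp add: Lp normal_cone_zero_def)
qed

lemma max_monotone_op_normal_cone_zero: "max_monotone_op (normal_cone_zero :: 'a::real_inner \<Rightarrow> 'a set)"
  using max_monotone_op_normal_cone_ker[of "\<lambda>x. x" "\<lambda>x. x" "\<lambda>x. x" "\<lambda>x. x"]
  by (simp add: bounded_linear.linear)

lemma monotone_fun_scaled:
  assumes "monotone_fun F"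
  shows "monotone_fun (\<lambda>x. c *\<^sub>R F (c *\<^sub>R x))"
proof -
  have "(x - y) \<bullet> (c *\<^sub>R F (c *\<^sub>R x) - c *\<^sub>R F (c *\<^sub>R y)) =
      (c *\<^sub>R x - c *\<^sub>R y) \<bullet> (F (c *\<^sub>R x) - F (c *\<^sub>R y))" for x y
    by (simp add: scaleR_diff_right[symmetric])
  then show ?thesis using assms by (simp add: monotone_fun_def)
qed

lemma monotone_fun_prod_fun:
  fixes F :: "'n::finite \<Rightarrow> 'a::real_inner \<Rightarrow> 'a"
  assumes "\<And>i. monotone_fun (F i)"
  shows "monotone_fun (prod_fun F)"
  using assms by (auto simp: monotone_fun_def prod_fun_def inner_vec_def intro!: sum_nonneg)

lemma monotone_fun_Pair_zero:
  assumes "monotone_fun F"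
  shows "monotone_fun (\<lambda>p. (F (fst p), 0 :: 'b::real_inner))"
  using assms by (simp add: monotone_fun_def inner_prod_def)

lemma lipschitz_on_scaled:
  fixes F :: "'a::real_normed_vector \<Rightarrow> 'b::real_normed_vector"
  assumes "lipschitz_on L UNIV F"
  shows "lipschitz_on (c\<^sup>2 * L) UNIV (\<lambda>x. c *\<^sub>R F (c *\<^sub>R x))"
proof -
  have "lipschitz_on (\<bar>c\<bar> * 1) UNIV (\<lambda>x::'a. c *\<^sub>R x)"
    by (rule lipschitz_on_cmult[OF lipschitz_on_id])
  then have "lipschitz_on (L * (\<bar>c\<bar> * 1)) UNIV (\<lambda>x. F (c *\<^sub>R x))"
    by (rule lipschitz_on_compose2) (rule lipschitz_on_subset[OF assms], simp)
  then have "lipschitz_on (\<bar>c\<bar> * (L * (\<bar>c\<bar> * 1))) UNIV (\<lambda>x. c *\<^sub>R F (c *\<^sub>R x))"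
    by (rule lipschitz_on_cmult)
  then show ?thesis by (simp add: power2_eq_square mult_ac)
qed

lemma lipschitz_on_prod_fun:
  fixes F :: "'n::finite \<Rightarrow> 'a::metric_space \<Rightarrow> 'a"
  assumes F: "\<And>i. lipschitz_on (L i) UNIV (F i)"
  shows "lipschitz_on (Max (range L)) UNIV (prod_fun F)"
proof (rule lipschitz_onI)
  have L_le: "L i \<le> Max (range L)" for i by simp
  then show "0 \<le> Max (range L)"
    using lipschitz_on_nonneg[OF F] order_trans by blast
  fix x y :: "'a^'n"
  have dist_le: "dist (F i (x $ i)) (F i (y $ i)) \<le> Max (range L) * dist (x $ i) (y $ i)" for i
    using lipschitz_onD[OF F] mult_right_mono[OF L_le zero_le_dist] by (meson UNIV_I order_trans)
  have "dist (prod_fun F x) (prod_fun F y) = L2_set (\<lambda>i. dist (F i (x $ i)) (F i (y $ i))) UNIV"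
    by (simp add: dist_vec_def prod_fun_def)
  also have "\<dots> \<le> L2_set (\<lambda>i. Max (range L) * dist (x $ i) (y $ i)) UNIV"
    by (intro L2_set_mono) (simp_all add: dist_le)
  also have "\<dots> = Max (range L) * dist x y"
    by (simp add: dist_vec_def L2_set_right_distrib \<open>0 \<le> Max (range L)\<close>)
  finally show "dist (prod_fun F x) (prod_fun F y) \<le> Max (range L) * dist x y" .
qed

lemma lipschitz_on_Pair_zero:
  fixes F :: "'a::metric_space \<Rightarrow> 'c::real_normed_vector"
  assumes "lipschitz_on C UNIV F"
  shows "lipschitz_on C UNIV (\<lambda>p :: 'a \<times> 'b::metric_space. (F (fst p), 0 :: 'c))"
proof (rule lipschitz_onI)
  show "0 \<le> C" using assms by (rule lipschitz_on_nonneg)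
  fix p q :: "'a \<times> 'b"
  have "dist (F (fst p)) (F (fst q)) \<le> C * dist (fst p) (fst q)"
    using assms by (rule lipschitz_onD) auto
  also have "\<dots> \<le> C * dist p q"
    using \<open>0 \<le> C\<close> by (intro mult_left_mono dist_fst_le)
  finally show "dist (F (fst p), 0 :: 'c) (F (fst q), 0) \<le> C * dist p q"
    by (simp add: dist_Pair_Pair)
qed

section \<open>Real matrices acting on \<open>H\<^sup>N\<close>\<close>

lemma linear_kron_act: "linear (kron_act P)"
  by (rule linearI) (simp_all add: kron_act_def vec_eq_iff scaleR_add_right sum.distrib scaleR_sum_right mult.commute)

lemma kron_act_matrix_mult: "kron_act (P ** Q) x = kron_act P (kron_act Q x)"
proof -
  have "(\<Sum>j\<in>UNIV. (\<Sum>k\<in>UNIV. P$i$k * Q$k$j) *\<^sub>R x$j) =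
      (\<Sum>j\<in>UNIV. \<Sum>k\<in>UNIV. (P$i$k * Q$k$j) *\<^sub>R x$j)" for i
    by (simp only: scaleR_sum_left)
  also have "\<dots> i = (\<Sum>k\<in>UNIV. \<Sum>j\<in>UNIV. (P$i$k * Q$k$j) *\<^sub>R x$j)" for i
    by (rule sum.swap)
  also have "\<dots> i = (\<Sum>k\<in>UNIV. P$i$k *\<^sub>R (\<Sum>j\<in>UNIV. Q$k$j *\<^sub>R x$j))" for i
    by (simp only: scaleR_sum_right scaleR_scaleR)
  finally show ?thesis by (simp add: kron_act_def matrix_matrix_mult_def vec_eq_iff)
qed

lemma kron_act_mat_1: "kron_act (mat 1) x = x"
  by (simp add: kron_act_def mat_def vec_eq_iff if_distrib[of "\<lambda>t. t *\<^sub>R _"] cong: if_cong)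

lemma kron_act_diff_matrix: "kron_act (P - Q) x = kron_act P x - kron_act Q x"
  by (simp add: kron_act_def vec_eq_iff scaleR_diff_left sum_subtractf)

lemma kron_act_scaleR_matrix: "kron_act (c *\<^sub>R P) x = c *\<^sub>R kron_act P x"
  by (simp add: kron_act_def vec_eq_iff scaleR_sum_right)

lemma kron_act_diag_mat: "kron_act (diag_mat g) x = (\<chi> i. g i *\<^sub>R x$i)"
  by (simp add: kron_act_def diag_mat_def vec_eq_iff if_distrib[of "\<lambda>t. t *\<^sub>R _"] cong: if_cong)

lemma transpose_diag_mat: "transpose (diag_mat g) = diag_mat g"
  by (simp add: transpose_def diag_mat_def vec_eq_iff)

lemma inner_kron_act:
  fixes x y :: "'a::real_inner^'n::finite"
  shows "kron_act P x \<bullet> y = x \<bullet> kron_act (transpose P) y"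
proof -
  have "kron_act P x \<bullet> y = (\<Sum>i\<in>UNIV. \<Sum>j\<in>UNIV. P$i$j * (x$j \<bullet> y$i))"
    by (simp add: inner_vec_def kron_act_def inner_sum_left)
  also have "\<dots> = (\<Sum>j\<in>UNIV. \<Sum>i\<in>UNIV. P$i$j * (x$j \<bullet> y$i))"
    by (rule sum.swap)
  also have "\<dots> = x \<bullet> kron_act (transpose P) y"
    by (simp add: inner_vec_def kron_act_def transpose_def inner_sum_right)
  finally show ?thesis .
qed

lemma kron_act_const: "kron_act P (\<chi> i. z) = (\<chi> i. (P *v vec 1)$i *\<^sub>R z)"
  by (simp add: kron_act_def matrix_vector_mult_def vec_eq_iff scaleR_sum_left)

lemma sum_kron_act: "(\<Sum>i\<in>UNIV. kron_act P x $ i) = (\<Sum>j\<in>UNIV. (transpose P *v vec 1)$j *\<^sub>R x$j)"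
proof -
  have "(\<Sum>i\<in>UNIV. kron_act P x $ i) = (\<Sum>i\<in>UNIV. \<Sum>j\<in>UNIV. P$i$j *\<^sub>R x$j)"
    by (simp add: kron_act_def)
  also have "\<dots> = (\<Sum>j\<in>UNIV. \<Sum>i\<in>UNIV. P$i$j *\<^sub>R x$j)"
    by (rule sum.swap)
  finally show ?thesis
    by (simp add: matrix_vector_mult_def transpose_def scaleR_sum_left)
qed

definition inner_coords :: "'a::real_inner \<Rightarrow> 'a^'n \<Rightarrow> real^'n" where
  "inner_coords h x = (\<chi> i. x$i \<bullet> h)"

lemma inner_coords_kron_act: "inner_coords h (kron_act P x) = P *v inner_coords h x"
  by (simp add: inner_coords_def kron_act_def vec_eq_iff matrix_vector_mult_def inner_sum_left)

lemma nth_eq_if_inner_coords_eq: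
  fixes x y :: "'a::real_inner^'n"
  assumes "\<And>h. inner_coords h x $ i = inner_coords h y $ j"
  shows "x $ i = y $ j"
proof -
  have "(x $ i - y $ j) \<bullet> (x $ i - y $ j) = 0"
    using assms[of "x $ i - y $ j"] by (simp add: inner_coords_def inner_diff_left)
  then show ?thesis by simp
qed

lemma ker_symmetric_matrix_square:
  fixes K :: "real^'n^'n"
  assumes "transpose K = K"
  shows "(K ** K) *v x = 0 \<longleftrightarrow> K *v x = 0"
proof
  assume "(K ** K) *v x = 0"
  then have "(K *v x) \<bullet> (K *v x) = 0"
    by (metis assms dot_lmul_matrix inner_zero_right matrix_vector_mul_assoc vector_transpose_matrix)
  then show "K *v x = 0" by simp
qed (simp add: matrix_vector_mul_assoc[symmetric])

lemma range_symmetric_matrix: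
  fixes K :: "real^'n^'n"
  assumes "transpose K = K"
  shows "range ((*v) K) = {r. \<forall>x. K *v x = 0 \<longrightarrow> x \<bullet> r = 0}"
proof -
  have "(*v) K -` {0} = (range ((*v) K))\<^sup>\<bottom>"
    using ker_orthogonal_comp_adjoint[of "(*v) K"] by (simp add: adjoint_matrix assms)
  then have "range ((*v) K) = ((*v) K -` {0})\<^sup>\<bottom>"
    by (simp add: orthogonal_comp_self linear_subspace_image)
  then show ?thesis by (auto simp: orthogonal_comp_def orthogonal_def)
qed

lemma ker_sqrt_mixing_matrix:
  fixes K W :: "real^'n::finite^'n"
  assumes "mixing_matrix E W" "transpose K = K" "K ** K = (1/2) *\<^sub>R (mat 1 - W)"
  shows "K *v r = 0 \<longleftrightarrow> (\<exists>t. r = t *\<^sub>R vec 1)"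
proof -
  have "K *v r = 0 \<longleftrightarrow> (mat 1 - W) *v r = 0"
    using ker_symmetric_matrix_square[OF assms(2), of r]
    by (simp add: assms(3) scaleR_matrix_vector_assoc[symmetric])
  then show ?thesis
    using assms(1) by (auto simp: mixing_matrix_def)
qed

lemma invertible_pd_mat:
  assumes "pd_mat M"
  shows "invertible M"
proof -
  have "M *v x = 0 \<Longrightarrow> x = 0" for x
    using assms by (metis inner_zero_right less_irrefl pd_mat_def)
  then show ?thesis
    by (simp add: invertible_left_inverse matrix_left_invertible_ker)
qed

lemma kron_act_eq_0_iff_const:
  fixes K :: "real^'n::finite^'n" and x :: "'a::real_inner^'n"
  assumes ker_K: "\<And>r. K *v r = 0 \<longleftrightarrow> (\<exists>t. r = t *\<^sub>R vec 1)"
  shows "kron_act K x = 0 \<longleftrightarrow> (\<exists>z. x = (\<chi> i. z))"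
proof
  assume K_x: "kron_act K x = 0"
  have "inner_coords h x $ i = inner_coords h x $ j" for h i j
  proof -
    have "K *v inner_coords h x = inner_coords h (kron_act K x)"
      by (simp add: inner_coords_kron_act)
    also have "\<dots> = 0"
      using K_x by (simp add: inner_coords_def vec_eq_iff)
    finally obtain t where "inner_coords h x = t *\<^sub>R vec 1"
      using ker_K by blast
    then show ?thesis by simp
  qed
  then have "x $ i = x $ j" for i j
    by (rule nth_eq_if_inner_coords_eq)
  then have "x = (\<chi> i. x $ j)" for j
    unfolding vec_eq_iff vec_lambda_beta by blast
  then show "\<exists>z. x = (\<chi> i. z)" by blast
next
  assume "\<exists>z. x = (\<chi> i. z)"
  then obtain z where x: "x = (\<chi> i. z)" ..
  have "K *v vec 1 = 0" using ker_K[of "vec 1"] by (metis scaleR_one)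
  then show "kron_act K x = 0"
    unfolding x kron_act_const by (simp add: vec_eq_iff)
qed

lemma kron_act_solvable_iff_sum_eq_0:
  fixes K :: "real^'n::finite^'n" and y :: "'a::real_inner^'n"
  assumes sym_K: "transpose K = K" and ker_K: "\<And>r. K *v r = 0 \<longleftrightarrow> (\<exists>t. r = t *\<^sub>R vec 1)"
  shows "(\<exists>v. kron_act K v = y) \<longleftrightarrow> (\<Sum>i\<in>UNIV. y $ i) = 0"
proof
  have "K *v vec 1 = 0" using ker_K[of "vec 1"] by (metis scaleR_one)
  then show "\<exists>v. kron_act K v = y \<Longrightarrow> (\<Sum>i\<in>UNIV. y $ i) = 0"
    using sum_kron_act[of K] sym_K by auto
next
  assume sum_y: "(\<Sum>i\<in>UNIV. y $ i) = 0"
  define N where "N = real CARD('n)"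
  define J :: "real^'n^'n" where "J = (\<chi> i j. 1)"
  have "range ((*v) K) = {r. \<forall>t. (t *\<^sub>R vec 1) \<bullet> r = 0}"
    unfolding range_symmetric_matrix[OF sym_K] ker_K by blast
  moreover have "vec 1 \<bullet> (axis j 1 - (1 / N) *\<^sub>R vec 1 :: real^'n) = 0" for j
    by (simp add: N_def inner_diff_right inner_vec_def sum_subtractf axis_def)
  ultimately have in_range: "axis j 1 - (1 / N) *\<^sub>R vec 1 \<in> range ((*v) K)" for j
    by (simp add: inner_scaleR_left)
  define s where "s j = inv_into UNIV ((*v) K) (axis j 1 - (1 / N) *\<^sub>R vec 1)" for j
  have s: "K *v s j = axis j 1 - (1 / N) *\<^sub>R vec 1" for j
    unfolding s_def using in_range by (rule f_inv_into_f)
  \<comment> \<open>\<open>P\<close> inverts \<open>K\<close> on zero-sum vectors: \<open>K P = I - J/N\<close> is the projection onto them.\<close>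
  define P :: "real^'n^'n" where "P = (\<chi> i j. s j $ i)"
  have "(K ** P) $ i $ j = (K *v s j) $ i" for i j
    by (simp add: P_def matrix_matrix_mult_def matrix_vector_mult_def)
  then have "K ** P = mat 1 - (1 / N) *\<^sub>R J"
    by (simp add: s vec_eq_iff J_def mat_def axis_def)
  moreover have "kron_act J y = 0"
    using sum_y by (simp add: J_def kron_act_def vec_eq_iff)
  ultimately have "kron_act K (kron_act P y) = y"
    by (simp add: kron_act_matrix_mult[symmetric] kron_act_diff_matrix kron_act_scaleR_matrix kron_act_mat_1)
  then show "\<exists>v. kron_act K v = y" by blast
qed

section \<open>Zeros of the lifted inclusion\<close>

lemma zero_in_sum_op3_iff:
  fixes G K M :: "real^'n::finite^'n" and A :: "'n \<Rightarrow> 'a::real_vector \<Rightarrow> 'a set"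
  assumes inj_G: "\<And>x :: 'a^'n. kron_act G x = 0 \<Longrightarrow> x = 0"
  shows "0 \<in> sum_op3 (tA A G) (tB B G) (tC G K M) (a, a2) \<longleftrightarrow>
     a2 = 0 \<and> kron_act K (kron_act G a) = 0 \<and>
     (\<exists>q \<in> prod_op A (kron_act G a). \<exists>v. q + prod_fun B (kron_act G a) + kron_act K v = 0)"
  (is "_ \<longleftrightarrow> _ \<and> _ \<and> (\<exists>q \<in> _. \<exists>v. ?e q v = 0)")
proof -
  have G_lin: "linear (kron_act G)" by (rule linear_kron_act)
  have fst_sum: "kron_act G q + fst (tB B G (a, a2)) + kron_act (G ** K) v = kron_act G (?e q v)" for q v
    by (simp add: tB_def kron_act_matrix_mult linear_add[OF G_lin])
  show ?thesis
  proof
    assume "0 \<in> sum_op3 (tA A G) (tB B G) (tC G K M) (a, a2)"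
    then obtain q n v where q: "q \<in> prod_op A (kron_act G a)" and n: "n \<in> normal_cone_zero a2"
      and v: "v \<in> normal_cone_zero (kron_act (K ** G) a + kron_act M a2)"
      and sum: "0 = (kron_act G q, n) + tB B G (a, a2) + (kron_act (G ** K) v, kron_act M v)"
      by (auto simp: sum_op3_def tA_def tC_def)
    have a2: "a2 = 0" using n by (simp add: normal_cone_zero_def split: if_splits)
    then have "kron_act K (kron_act G a) = 0"
      using v by (simp add: normal_cone_zero_def kron_act_matrix_mult linear_0[OF linear_kron_act]
          split: if_splits)
    moreover have "kron_act G (?e q v) = 0"
      using fst_sum arg_cong[OF sum, of fst] by simp
    then have "?e q v = 0" by (rule inj_G)
    ultimately show "a2 = 0 \<and> kron_act K (kron_act G a) = 0 \<and> (\<exists>q \<in> prod_op A (kron_act G a). \<exists>v. ?e q v = 0)"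
      using a2 q by blast
  next
    assume "a2 = 0 \<and> kron_act K (kron_act G a) = 0 \<and> (\<exists>q \<in> prod_op A (kron_act G a). \<exists>v. ?e q v = 0)"
    then obtain q v where a2: "a2 = 0" and K_Ga: "kron_act K (kron_act G a) = 0"
      and q: "q \<in> prod_op A (kron_act G a)" and e: "?e q v = 0"
      by blast
    have "(kron_act G q, - kron_act M v) \<in> tA A G (a, a2)"
      using q a2 by (simp add: tA_def normal_cone_zero_def)
    moreover have "(kron_act (G ** K) v, kron_act M v) \<in> tC G K M (a, a2)"
      using K_Ga a2 by (simp add: tC_def normal_cone_zero_def kron_act_matrix_mult linear_0[OF linear_kron_act])
    moreover have "0 = (kron_act G q, - kron_act M v) + tB B G (a, a2) + (kron_act (G ** K) v, kron_act M v)"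
      using fst_sum[of q v] e by (simp add: prod_eq_iff tB_def linear_0[OF G_lin])
    ultimately show "0 \<in> sum_op3 (tA A G) (tB B G) (tC G K M) (a, a2)"
      unfolding sum_op3_def by blast
  qed
qed

lemma zero_in_prod_op_plus_range_iff:
  fixes K :: "real^'n::finite^'n" and A :: "'n \<Rightarrow> 'a::real_inner \<Rightarrow> 'a set"
  assumes sym_K: "transpose K = K" and ker_K: "\<And>r. K *v r = 0 \<longleftrightarrow> (\<exists>t. r = t *\<^sub>R vec 1)"
  shows "(\<exists>q \<in> prod_op A (\<chi> i. z). \<exists>v. q + prod_fun B (\<chi> i. z) + kron_act K v = 0) \<longleftrightarrow>
      (\<exists>y. (\<forall>i. y i \<in> A i z) \<and> (\<Sum>i\<in>UNIV. y i + B i z) = 0)"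
proof -
  have "(\<exists>v. q + prod_fun B (\<chi> i. z) + kron_act K v = 0) \<longleftrightarrow>
      (\<exists>v. kron_act K v = - (q + prod_fun B (\<chi> i. z)))" for q
    by (metis add.commute eq_neg_iff_add_eq_0)
  also have "\<dots> q \<longleftrightarrow> (\<Sum>i\<in>UNIV. (- (q + prod_fun B (\<chi> i. z))) $ i) = 0" for q
    by (rule kron_act_solvable_iff_sum_eq_0[OF sym_K ker_K])
  also have "\<dots> q \<longleftrightarrow> (\<Sum>i\<in>UNIV. q $ i + B i z) = 0" for q
    unfolding vector_uminus_component vector_add_component prod_fun_def vec_lambda_beta sum_negf
    by simp
  finally have balance: "(\<exists>v. q + prod_fun B (\<chi> i. z) + kron_act K v = 0) \<longleftrightarrow>
      (\<Sum>i\<in>UNIV. q $ i + B i z) = 0" for q .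
  show ?thesis
  proof
    assume "\<exists>q \<in> prod_op A (\<chi> i. z). \<exists>v. q + prod_fun B (\<chi> i. z) + kron_act K v = 0"
    then obtain q where "\<forall>i. q $ i \<in> A i z" "(\<Sum>i\<in>UNIV. q $ i + B i z) = 0"
      by (auto simp: prod_op_def balance)
    then show "\<exists>y. (\<forall>i. y i \<in> A i z) \<and> (\<Sum>i\<in>UNIV. y i + B i z) = 0"
      by (intro exI[of _ "($) q"]) simp
  next
    assume "\<exists>y. (\<forall>i. y i \<in> A i z) \<and> (\<Sum>i\<in>UNIV. y i + B i z) = 0"
    then obtain y where "\<forall>i. y i \<in> A i z" "(\<Sum>i\<in>UNIV. y i + B i z) = 0"
      by blast
    then show "\<exists>q \<in> prod_op A (\<chi> i. z). \<exists>v. q + prod_fun B (\<chi> i. z) + kron_act K v = 0"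
      by (intro bexI[of _ "\<chi> i. y i"]) (simp_all add: prod_op_def balance)
  qed
qed

lemma zero_in_sum_op3_iff_consensus:
  fixes K M :: "real^'n::finite^'n" and A :: "'n \<Rightarrow> 'a::real_inner \<Rightarrow> 'a set"
  assumes \<gamma>: "\<forall>i. \<gamma> i \<noteq> 0"
    and sym_K: "transpose K = K" and ker_K: "\<And>r. K *v r = 0 \<longleftrightarrow> (\<exists>t. r = t *\<^sub>R vec 1)"
  shows "0 \<in> sum_op3 (tA A (diag_mat \<gamma>)) (tB B (diag_mat \<gamma>)) (tC (diag_mat \<gamma>) K M) (a, a2) \<longleftrightarrow>
     a2 = 0 \<and> (\<exists>z. a = (\<chi> i. inverse (\<gamma> i) *\<^sub>R z) \<and>
                 (\<exists>y. (\<forall>i. y i \<in> A i z) \<and> (\<Sum>i\<in>UNIV. y i + B i z) = 0))"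
proof -
  let ?G = "diag_mat \<gamma>"
  have "\<gamma> i *\<^sub>R a $ i = z \<longleftrightarrow> a $ i = inverse (\<gamma> i) *\<^sub>R z" for i z
    using \<gamma> by auto
  then have G_const: "kron_act ?G a = (\<chi> i. z) \<longleftrightarrow> a = (\<chi> i. inverse (\<gamma> i) *\<^sub>R z)" for z
    by (simp add: kron_act_diag_mat vec_eq_iff)
  have inj_G: "kron_act ?G x = 0 \<Longrightarrow> x = 0" for x :: "'a^'n"
    using \<gamma> by (simp add: kron_act_diag_mat vec_eq_iff)
  have "0 \<in> sum_op3 (tA A ?G) (tB B ?G) (tC ?G K M) (a, a2) \<longleftrightarrow>
      a2 = 0 \<and> kron_act K (kron_act ?G a) = 0 \<and>
      (\<exists>q \<in> prod_op A (kron_act ?G a). \<exists>v. q + prod_fun B (kron_act ?G a) + kron_act K v = 0)"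
    by (rule zero_in_sum_op3_iff[OF inj_G])
  also have "\<dots> \<longleftrightarrow> a2 = 0 \<and> (\<exists>z. kron_act ?G a = (\<chi> i. z) \<and>
      (\<exists>q \<in> prod_op A (\<chi> i. z). \<exists>v. q + prod_fun B (\<chi> i. z) + kron_act K v = 0))"
    by (auto simp: kron_act_eq_0_iff_const[OF ker_K]) blast+
  finally show ?thesis
    by (simp only: G_const zero_in_prod_op_plus_range_iff[OF sym_K ker_K])
qed

section \<open>Monotonicity of the lifted operators\<close>

lemma tA_diag_mat:
  "tA A (diag_mat \<gamma>) p =
     prod_op (\<lambda>i x. (*\<^sub>R) (\<gamma> i) ` A i (\<gamma> i *\<^sub>R x)) (fst p) \<times> normal_cone_zero (snd p)"
proof -
  have "kron_act (diag_mat \<gamma>) ` prod_op A (kron_act (diag_mat \<gamma>) x) =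
      prod_op (\<lambda>i x. (*\<^sub>R) (\<gamma> i) ` A i (\<gamma> i *\<^sub>R x)) x" for x
  proof
    show "kron_act (diag_mat \<gamma>) ` prod_op A (kron_act (diag_mat \<gamma>) x) \<subseteq>
        prod_op (\<lambda>i x. (*\<^sub>R) (\<gamma> i) ` A i (\<gamma> i *\<^sub>R x)) x"
      by (auto simp: prod_op_def kron_act_diag_mat)
    show "prod_op (\<lambda>i x. (*\<^sub>R) (\<gamma> i) ` A i (\<gamma> i *\<^sub>R x)) x \<subseteq>
        kron_act (diag_mat \<gamma>) ` prod_op A (kron_act (diag_mat \<gamma>) x)"
    proof
      fix y
      assume "y \<in> prod_op (\<lambda>i x. (*\<^sub>R) (\<gamma> i) ` A i (\<gamma> i *\<^sub>R x)) x"
      then have "\<forall>i. \<exists>q. q \<in> A i (\<gamma> i *\<^sub>R x $ i) \<and> y $ i = \<gamma> i *\<^sub>R q"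
        unfolding prod_op_def by blast
      then obtain q where q: "\<forall>i. q i \<in> A i (\<gamma> i *\<^sub>R x $ i) \<and> y $ i = \<gamma> i *\<^sub>R q i"
        using choice[of "\<lambda>i q. q \<in> A i (\<gamma> i *\<^sub>R x $ i) \<and> y $ i = \<gamma> i *\<^sub>R q"] by blast
      then have "y = kron_act (diag_mat \<gamma>) (\<chi> i. q i)"
        by (simp add: kron_act_diag_mat vec_eq_iff)
      moreover have "(\<chi> i. q i) \<in> prod_op A (kron_act (diag_mat \<gamma>) x)"
        using q by (simp add: prod_op_def kron_act_diag_mat)
      ultimately show "y \<in> kron_act (diag_mat \<gamma>) ` prod_op A (kron_act (diag_mat \<gamma>) x)"
        by blast
    qed
  qed
  then show ?thesis by (simp add: tA_def)
qed

lemma tB_diag_mat: "tB B (diag_mat \<gamma>) p = (prod_fun (\<lambda>i x. \<gamma> i *\<^sub>R B i (\<gamma> i *\<^sub>R x)) (fst p), 0)"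
  by (simp add: tB_def kron_act_diag_mat prod_fun_def)

lemma max_monotone_tC:
  fixes G K M M' :: "real^'n::finite^'n"
  assumes "transpose G = G" "transpose K = K" "transpose M = M" and M': "M ** M' = mat 1"
  shows "max_monotone_op (tC G K M :: ('a::real_inner^'n) \<times> ('a^'n) \<Rightarrow> _)"
proof -
  let ?L = "\<lambda>p :: ('a^'n) \<times> ('a^'n). kron_act (K ** G) (fst p) + kron_act M (snd p)"
  let ?L' = "\<lambda>v. (kron_act (G ** K) v, kron_act M v)"
  have "max_monotone_op (\<lambda>p. ?L' ` normal_cone_zero (?L p))"
  proof (rule max_monotone_op_normal_cone_ker[where R = "\<lambda>v. (0, kron_act M' v)"
        and R' = "\<lambda>p. kron_act (transpose M') (snd p)"])
    show "linear ?L"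
      by (intro linearI) (simp_all add: linear_add[OF linear_kron_act] linear_scale[OF linear_kron_act]
          scaleR_add_right)
    show "?L p \<bullet> v = p \<bullet> ?L' v" for p v
      by (simp add: inner_prod_def inner_add_left inner_kron_act matrix_transpose_mul assms)
    show "?L (0, kron_act M' v) = v" for v
      by (simp add: linear_0[OF linear_kron_act] kron_act_matrix_mult[symmetric] M' kron_act_mat_1)
    show "(0, kron_act M' v) \<bullet> p = v \<bullet> kron_act (transpose M') (snd p)" for v p
      by (simp add: inner_prod_def inner_kron_act)
  qed
  then show ?thesis by (simp add: tC_def[abs_def])
qed

lemma lifted_operators_monotone:
  fixes A :: "'n::finite \<Rightarrow> 'a::real_inner \<Rightarrow> 'a set" and B :: "'n \<Rightarrow> 'a \<Rightarrow> 'a"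
    and K M M' :: "real^'n^'n"
  assumes \<gamma>: "\<forall>i. \<gamma> i \<noteq> 0" and "transpose K = K" "transpose M = M" "M ** M' = mat 1"
    and A: "\<forall>i. max_monotone_op (A i)" and B_mono: "\<forall>i. monotone_fun (B i)"
    and B_lip: "\<forall>i. lipschitz_on (L i) UNIV (B i)"
  shows "max_monotone_op (tA A (diag_mat \<gamma>)) \<and>
    max_monotone_op (tC (diag_mat \<gamma>) K M :: ('a^'n) \<times> ('a^'n) \<Rightarrow> _) \<and>
    monotone_fun (tB B (diag_mat \<gamma>)) \<and>
    lipschitz_on (Max (range (\<lambda>i. (\<gamma> i)\<^sup>2 * L i))) UNIV (tB B (diag_mat \<gamma>))"
proof (intro conjI)
  show "max_monotone_op (tA A (diag_mat \<gamma>))"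
    unfolding tA_diag_mat[abs_def]
    using \<gamma> A by (intro max_monotone_op_Times max_monotone_prod_op max_monotone_op_scaled
        max_monotone_op_normal_cone_zero) auto
  show "max_monotone_op (tC (diag_mat \<gamma>) K M :: ('a^'n) \<times> ('a^'n) \<Rightarrow> _)"
    using transpose_diag_mat assms(2-4) by (rule max_monotone_tC)
  show "monotone_fun (tB B (diag_mat \<gamma>))"
    unfolding tB_diag_mat[abs_def]
    using B_mono by (intro monotone_fun_Pair_zero monotone_fun_prod_fun monotone_fun_scaled) auto
  show "lipschitz_on (Max (range (\<lambda>i. (\<gamma> i)\<^sup>2 * L i))) UNIV (tB B (diag_mat \<gamma>))"
    unfolding tB_diag_mat[abs_def]
    using B_lip by (intro lipschitz_on_Pair_zero lipschitz_on_prod_fun lipschitz_on_scaled) auto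
qed

theorem lemma3p3:
  fixes A :: "'n::finite \<Rightarrow> 'a::{real_inner, complete_space} \<Rightarrow> 'a set"
    and B :: "'n \<Rightarrow> 'a \<Rightarrow> 'a"
    and E :: "('n \<times> 'n) set"
    and W K M :: "real^'n^'n"
    and \<gamma> :: "'n \<Rightarrow> real"
    and c :: real
  assumes conn: "connected_graph E"
    and mix: "mixing_matrix E W"
    and gpos: "\<forall>i. 0 < \<gamma> i"
    and K_sqrt: "psd_mat K" "K ** K = (1/2) *\<^sub>R (mat 1 - W)"
    and c_big: "c > onorm (\<lambda>x. (diag_mat \<gamma> ** K ** K ** diag_mat \<gamma>) *v x)"
    and M_sqrt: "psd_mat M"
      "M ** M = c *\<^sub>R mat 1 - K ** diag_mat \<gamma> ** diag_mat \<gamma> ** K"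
    and M_pd: "pd_mat M"
  shows
    "(\<forall>a a2. (0 \<in> sum_op3 (tA A (diag_mat \<gamma>)) (tB B (diag_mat \<gamma>))
                           (tC (diag_mat \<gamma>) K M) (a, a2))
        \<longleftrightarrow> a2 = 0 \<and>
            (\<exists>z. a = (\<chi> i. inverse (\<gamma> i) *\<^sub>R z) \<and>
                 (\<exists>y. (\<forall>i. y i \<in> A i z) \<and> (\<Sum>i\<in>UNIV. y i + B i z) = 0)))
     \<and>
     (\<forall>L :: 'n \<Rightarrow> real.
        (\<forall>i. max_monotone_op (A i)) \<and> (\<forall>i. monotone_fun (B i)) \<and>
        (\<forall>i. lipschitz_on (L i) UNIV (B i))
        \<longrightarrow> max_monotone_op (tA A (diag_mat \<gamma>)) \<and>
            max_monotone_op (tC (diag_mat \<gamma>) K M :: ('a^'n) \<times> ('a^'n) \<Rightarrow> _) \<and>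
            monotone_fun (tB B (diag_mat \<gamma>)) \<and>
            lipschitz_on (Max (range (\<lambda>i. (\<gamma> i)\<^sup>2 * L i))) UNIV (tB B (diag_mat \<gamma>)))"
proof -
  have sym_K: "transpose K = K" and sym_M: "transpose M = M"
    using K_sqrt(1) M_pd by (simp_all add: psd_mat_def pd_mat_def sym_mat_def)
  have ker_K: "K *v r = 0 \<longleftrightarrow> (\<exists>t. r = t *\<^sub>R vec 1)" for r
    using ker_sqrt_mixing_matrix[OF mix sym_K K_sqrt(2)] .
  obtain M' where M': "M ** M' = mat 1"
    using invertible_pd_mat[OF M_pd] invertible_right_inverse by blast
  have \<gamma>: "\<forall>i. \<gamma> i \<noteq> 0"
    using gpos by (metis less_irrefl)
  show ?thesis
    using lifted_operators_monotone[OF \<gamma> sym_K sym_M M']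
    by (intro conjI allI impI zero_in_sum_op3_iff_consensus[OF \<gamma> sym_K ker_K]) auto
qed

end
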